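(* Let $n,r$ be positive integers and $u=n/r$. If $\sqrt{n\log n}\le r\le n$, then $$\nu(n,r)=\varrho(u)\left(1+O\left(\frac{u\log(u+1)}{r}\right)\right).$$
   Context: $S_n$ is the symmetric group on $n$ symbols and $k_j(\sigma)$ is the number of cycles of length $j$ in $\sigma\in S_n$. For $1\le r\le n$, $$\nu(n,r)=\frac1{n!}\left|\{\sigma\in S_n:\ k_j(\sigma)=0 \text{ for all } r+1\le j\le n\}\right|.$$ $\varrho$ is the Dickman function: the continuous function on $[0,\infty)$ with $\varrho(v)=1$ for $v\in[0,1]$ and $v\varrho'(v)+\varrho(v-1)=0$ for $v>1$. The implied constant in $O(\cdot)$ is absolute (uniform over all $n,r$ in the stated range). $\log$ is the natural logarithm. *)

theory Defs
  imports "HOL-Analysis.Analysis" "HOL-Combinatorics.Orbits"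
begin

text \<open>
  The cycles of a permutation \<open>\<sigma>\<close> of \<open>{1..n}\<close> are identified with its orbits on \<open>{1..n}\<close>, so that a
  fixed point is a cycle of length 1. The ground set must be supplied since \<open>\<sigma>\<close>, as a function on
  \<open>nat\<close>, fixes every point outside \<open>{1..n}\<close>.
\<close>

definition cycle_count :: "nat \<Rightarrow> nat \<Rightarrow> (nat \<Rightarrow> nat) \<Rightarrow> nat" where
  "cycle_count n j \<sigma> = card {C \<in> orbit \<sigma> ` {1..n}. card C = j}"

definition \<nu> :: "nat \<Rightarrow> nat \<Rightarrow> real" where
  "\<nu> n r = real (card {\<sigma>. \<sigma> permutes {1..n} \<and> (\<forall>j\<in>{r+1..n}. cycle_count n j \<sigma> = 0)}) / fact n"

text \<open>
  The defining properties of the Dickman function only speak about \<open>[0,\<infinity>)\<close>. Requiring the value 0 on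
  the negative axis merely makes the description unique as a function on the type of real numbers.
\<close>

definition is_dickman :: "(real \<Rightarrow> real) \<Rightarrow> bool" where
  "is_dickman f \<longleftrightarrow>
     continuous_on {0..} f \<and>
     (\<forall>v\<in>{0..1}. f v = 1) \<and>
     (\<forall>v>1. f differentiable (at v) \<and> v * deriv f v + f (v - 1) = 0) \<and>
     (\<forall>v<0. f v = 0)"

definition dickman :: "real \<Rightarrow> real" where
  "dickman = (THE f. is_dickman f)"

lemma is_dickman_unique:
  assumes f: "is_dickman f" and g: "is_dickman g"
  shows "f = g"
proof -
  have D: "(h has_real_derivative (- h (v - 1) / v)) (at v)" if "is_dickman h" "v > 1" for h v
  proof -
    have "h differentiable (at v)" and e: "v * deriv h v + h (v - 1) = 0"
      using that unfolding is_dickman_def by blast+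
    then have "(h has_real_derivative deriv h v) (at v)"
      using DERIV_deriv_iff_real_differentiable by blast
    moreover have "deriv h v = - h (v - 1) / v"
      using e that(2) by (simp add: field_simps)
    ultimately show ?thesis by simp
  qed
  have eq: "\<forall>v. 0 \<le> v \<and> v \<le> real (Suc k) \<longrightarrow> f v = g v" for k
  proof (induction k)
    case 0
    then show ?case using f g by (auto simp: is_dickman_def)
  next
    case (Suc k)
    show ?case
    proof (intro allI impI)
      fix v :: real
      assume v: "0 \<le> v \<and> v \<le> real (Suc (Suc k))"
      show "f v = g v"
      proof (cases "v \<le> real (Suc k)")
        case True
        then show ?thesis using Suc v by auto
      next
        case False
        define a where "a = real (Suc k)"
        have a: "a < v" "1 \<le> a" using False by (auto simp: a_def)
        have c: "continuous_on {a..v} (\<lambda>x. f x - g x)"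
          using f g a unfolding is_dickman_def
          by (intro continuous_intros) (auto intro: continuous_on_subset)
        have d: "((\<lambda>x. f x - g x) has_real_derivative 0) (at x)" if "a < x" "x < v" for x
        proof -
          have "f (x - 1) = g (x - 1)" using Suc that a v by (auto simp: a_def)
          then show ?thesis
            using DERIV_diff[OF D[OF f, of x] D[OF g, of x]] that a by auto
        qed
        have "f v - g v = f a - g a"
          using DERIV_isconst_end[OF a(1) c] d by auto
        moreover have "f a = g a" using Suc by (auto simp: a_def)
        ultimately show ?thesis by simp
      qed
    qed
  qed
  show ?thesis
  proof
    fix v
    show "f v = g v"
    proof (cases "v < 0")
      case True
      then show ?thesis using f g by (auto simp: is_dickman_def)
    next
      case False
      moreover have "v \<le> real (Suc (nat \<lceil>v\<rceil>))" by linarith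
      ultimately show ?thesis using eq[of "nat \<lceil>v\<rceil>"] by auto
    qed
  qed
qed

text \<open>
  Existence by Picard iteration: the iterates of the integrated equation stabilise on \<open>(-\<infinity>, k + 1]\<close>
  after \<open>k\<close> steps.
\<close>

primrec dickman_iter :: "nat \<Rightarrow> real \<Rightarrow> real" where
  "dickman_iter 0 = (\<lambda>v. 1)"
| "dickman_iter (Suc k) =
     (\<lambda>v. if v \<le> 1 then 1 else 1 - integral {1..v} (\<lambda>t. dickman_iter k (t - 1) / t))"

lemma dickman_iter_step:
  assumes c: "continuous_on UNIV (dickman_iter k)"
  shows "(\<forall>v>1. (dickman_iter (Suc k) has_real_derivative (- dickman_iter k (v - 1) / v)) (at v))
      \<and> continuous_on UNIV (dickman_iter (Suc k))"
proof -
  let ?h = "\<lambda>t. dickman_iter k (t - 1) / t"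
  let ?I = "\<lambda>v. 1 - integral {1..v} ?h"
  have ch: "continuous_on {1..b} ?h" for b
    by (intro continuous_intros continuous_on_compose2[OF c]) auto
  have d: "(?I has_real_derivative (- ?h v)) (at v)" if "v > 1" for v
  proof -
    have "((\<lambda>v. integral {1..v} ?h) has_real_derivative ?h v) (at v within {1..v + 1})"
      using integral_has_real_derivative[OF ch] that by auto
    moreover have "at v within {1..v + 1} = at v"
      using that by (intro at_within_interior) auto
    ultimately show ?thesis by (auto intro!: derivative_eq_intros)
  qed
  have d': "(dickman_iter (Suc k) has_real_derivative (- ?h v)) (at v)" if "v > 1" for v
  proof (rule has_field_derivative_transform_within_open[OF d[OF that]])
    show "open {1::real<..}" "v \<in> {1<..}" using that by auto
  qed auto
  have "continuous_on {1..} ?I"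
  proof (rule continuous_on_diff)
    show "continuous_on {1..} (\<lambda>v. integral {1..v} ?h)"
    proof (unfold continuous_on_eq_continuous_within, intro ballI)
      fix x :: real assume x: "x \<in> {1..}"
      have "continuous_on {1..x + 1} (\<lambda>v. integral {1..v} ?h)"
        by (rule indefinite_integral_continuous_1[OF integrable_continuous_interval[OF ch]])
      then have "continuous (at x within {1..x + 1}) (\<lambda>v. integral {1..v} ?h)"
        using x by (auto simp: continuous_on_eq_continuous_within)
      moreover have "at x within {1..x + 1} = at x within {1..}"
        by (rule at_within_nhd[of _ "{..<x + 1}"]) auto
      ultimately show "continuous (at x within {1..}) (\<lambda>v. integral {1..v} ?h)"
        by simp
    qed
  qed auto
  then have "continuous_on ({..1} \<union> {1..}) (\<lambda>v. if v \<le> 1 then 1 else ?I v)"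
  proof (intro continuous_on_If)
    show "1 = ?I x" if "x \<in> {1..}" "x \<le> 1" for x
    proof -
      from that have "x = 1" by simp
      then show ?thesis by simp
    qed
  qed simp_all
  moreover have "{..1} \<union> {1..} = (UNIV :: real set)" by auto
  ultimately have "continuous_on UNIV (dickman_iter (Suc k))"
    unfolding dickman_iter.simps(2) by simp
  with d' show ?thesis by (simp del: dickman_iter.simps)
qed

lemma dickman_iter_cont_deriv:
  "continuous_on UNIV (dickman_iter k) \<and>
   (\<forall>v>1. (dickman_iter (Suc k) has_real_derivative (- dickman_iter k (v - 1) / v)) (at v))"
proof (induction k)
  case 0
  have "continuous_on UNIV (dickman_iter 0)" by simp
  with dickman_iter_step[of 0] show ?case by blast
next
  case (Suc k)
  with dickman_iter_step[of k] dickman_iter_step[of "Suc k"] show ?case by blast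
qed

lemma dickman_iter_stable_Suc: "v \<le> real (Suc k) \<Longrightarrow> dickman_iter (Suc k) v = dickman_iter k v"
proof (induction k arbitrary: v)
  case 0
  then show ?case by simp
next
  case (Suc k)
  have "integral {1..v} (\<lambda>t. dickman_iter (Suc k) (t - 1) / t) =
        integral {1..v} (\<lambda>t. dickman_iter k (t - 1) / t)"
  proof (rule integral_cong)
    fix t assume "t \<in> {1..v}"
    then have "t - 1 \<le> real (Suc k)" using Suc.prems by auto
    from Suc.IH[OF this]
    show "dickman_iter (Suc k) (t - 1) / t = dickman_iter k (t - 1) / t" by simp
  qed
  then show ?case unfolding dickman_iter.simps(2)[of "Suc k"] dickman_iter.simps(2)[of k] by simp
qed

lemma dickman_iter_stable:
  assumes "v \<le> real (Suc k)" "k \<le> m"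
  shows "dickman_iter m v = dickman_iter k v"
  using assms(2)
proof (induction m rule: dec_induct)
  case (step m)
  have "dickman_iter (Suc m) v = dickman_iter m v"
    by (rule dickman_iter_stable_Suc) (use assms(1) step in auto)
  then show ?case using step by simp
qed simp

lemma is_dickman_exists: "\<exists>f. is_dickman f"
proof
  define f where "f = (\<lambda>v::real. if v < 0 then 0 else dickman_iter (nat \<lceil>v\<rceil>) v)"
  have f: "f v = dickman_iter k v" if "0 \<le> v" "v \<le> real (Suc k)" for v k
  proof -
    have "v \<le> real (Suc (nat \<lceil>v\<rceil>))" by linarith
    then have "dickman_iter (nat \<lceil>v\<rceil>) v = dickman_iter k v"
      using dickman_iter_stable[of v k "nat \<lceil>v\<rceil>"] dickman_iter_stable[of v "nat \<lceil>v\<rceil>" k] that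
      by (cases "k \<le> nat \<lceil>v\<rceil>") auto
    then show ?thesis using that by (simp add: f_def)
  qed
  have loc: "\<exists>k. x + 1 \<le> real (Suc k)" for x :: real
    by (rule exI[of _ "nat \<lceil>x\<rceil>"]) linarith
  show "is_dickman f"
    unfolding is_dickman_def
  proof (intro conjI allI ballI impI)
    show "continuous_on {0..} f"
      unfolding continuous_on_eq_continuous_within
    proof
      fix x :: real assume x: "x \<in> {0..}"
      obtain k where k: "x + 1 \<le> real (Suc k)" using loc by blast
      have "continuous_on {0..x + 1} (dickman_iter k)"
        using dickman_iter_cont_deriv continuous_on_subset by blast
      then have "continuous_on {0..x + 1} f"
        by (rule continuous_on_eq) (use f[of _ k] k in auto)
      then have "continuous (at x within {0..x + 1}) f"
        using x by (auto simp: continuous_on_eq_continuous_within)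
      moreover have "at x within {0..x + 1} = at x within {0..}"
        by (rule at_within_nhd[of _ "{..<x + 1}"]) auto
      ultimately show "continuous (at x within {0..}) f" by simp
    qed
  next
    fix v :: real assume "v \<in> {0..1}"
    then show "f v = 1" using f[of v 0] by simp
  next
    fix v :: real assume v: "1 < v"
    obtain k where k: "v + 1 \<le> real (Suc k)" using loc by blast
    have "(dickman_iter (Suc k) has_real_derivative (- dickman_iter k (v - 1) / v)) (at v)"
      using dickman_iter_cont_deriv v by blast
    then have d: "(f has_real_derivative (- dickman_iter k (v - 1) / v)) (at v)"
    proof (rule has_field_derivative_transform_within_open)
      show "open {1<..<v + 1}" "v \<in> {1<..<v + 1}" using v by auto
      show "dickman_iter (Suc k) x = f x" if "x \<in> {1<..<v + 1}" for x
        using f[of x "Suc k"] that k by auto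
    qed
    then show "f differentiable (at v)"
      using real_differentiable_def by blast
    have "dickman_iter k (v - 1) = f (v - 1)" using f[of "v - 1" k] v k by auto
    with DERIV_imp_deriv[OF d] show "v * deriv f v + f (v - 1) = 0"
      using v by simp
  next
    fix v :: real assume "v < 0"
    then show "f v = 0" by (simp add: f_def)
  qed
qed

lemma is_dickman_dickman: "is_dickman dickman"
proof -
  from is_dickman_exists obtain f where f: "is_dickman f" ..
  then show ?thesis
    unfolding dickman_def using theI[of is_dickman, OF f] is_dickman_unique[OF _ f] by blast
qed

end

theory Submission
  imports Defs "HOL-Combinatorics.Cycles"
begin

text \<open>
  The proof traps \<open>\<nu>(n,r)\<close> between two values of the Dickman function \<open>\<rho>\<close>,
  \<open>\<rho>(n/r) \<le> \<nu>(n,r) \<le> \<rho>(n/(r+1))\<close>, and then shows that moving the argument from \<open>n/r\<close> to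
  \<open>n/(r+1)\<close> changes \<open>\<rho>\<close> only by the claimed relative error.

  The two bounds come from comparing a recurrence with an integral equation. Sorting permutations by
  the cycle through a chosen point gives \<open>n \<nu>(n,r) = \<nu>(n-1,r) + ... + \<nu>(n-r,r)\<close> for \<open>n > r\<close>
  (\<open>nu_recurrence\<close>), whereas \<open>x \<rho>(x)\<close> is the integral of \<open>\<rho>\<close> over \<open>[x-1,x]\<close>
  (\<open>dickman_delay_integral\<close>). Since \<open>\<rho>\<close> is decreasing, its Riemann sums with step \<open>1/s\<close> lie
  above or below the integral according to whether left or right endpoints are used
  (\<open>dickman_riemann_sum\<close>). With \<open>s = r\<close> and left endpoints, \<open>m \<mapsto> \<rho>(m/r)\<close> is a subsolution of the
  recurrence. With \<open>s = r+1\<close> the sum over right endpoints has \<open>r+1\<close> terms; dropping the one at \<open>m\<close>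
  itself leaves exactly the \<open>r\<close> terms of the recurrence, so \<open>m \<mapsto> \<rho>(m/(r+1))\<close> is a
  supersolution. Induction on \<open>n\<close> then yields both bounds.

  For the comparison of \<open>\<rho>(n/r)\<close> with \<open>\<rho>(n/(r+1))\<close> one needs that the logarithmic derivative
  \<open>-\<rho>'(t)/\<rho>(t) = \<rho>(t-1)/(t \<rho>(t))\<close> is \<open>O(log(u+1))\<close> for \<open>t \<le> u\<close> (\<open>dickman_decay\<close>). It is
  proved in steps of length \<open>1/2\<close>: a bound \<open>K\<close> on \<open>[0,T]\<close> limits how much \<open>\<rho>\<close> can drop on
  \<open>[t-1,t-1/2]\<close>, hence bounds the integral \<open>t \<rho>(t)\<close> below, which gives the bound
  \<open>K/(1-exp(-K/2))\<close> on \<open>[0,T+1/2]\<close>. The growth \<open>K exp(-K/2)\<close> per step is so small that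
  \<open>K = 4 ln(i+3)\<close> survives \<open>i\<close> steps.

  Finally \<open>n/r - n/(r+1) \<le> u/r\<close>, so the relative error is at most \<open>exp(8X) - 1\<close> with
  \<open>X = u ln(u+1)/r\<close>. The hypothesis \<open>r \<ge> sqrt(n ln n)\<close> gives \<open>X \<le> 2\<close>
  (\<open>error_term_bounded\<close>), and then \<open>exp(8X) - 1 = O(X)\<close>.
\<close>

section \<open>The Dickman function as an integral over a unit interval\<close>

lemma dickman_eq_1: "0 \<le> v \<Longrightarrow> v \<le> 1 \<Longrightarrow> dickman v = 1"
  using is_dickman_dickman by (auto simp: is_dickman_def)

lemma continuous_on_dickman: "A \<subseteq> {0..} \<Longrightarrow> continuous_on A dickman"
  using is_dickman_dickman continuous_on_subset by (auto simp: is_dickman_def)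

lemma dickman_has_derivative:
  assumes "v > 1"
  shows "(dickman has_real_derivative (- dickman (v - 1) / v)) (at v)"
proof -
  have d: "dickman differentiable (at v)" and e: "v * deriv dickman v + dickman (v - 1) = 0"
    using is_dickman_dickman assms unfolding is_dickman_def by blast+
  have "deriv dickman v = - dickman (v - 1) / v"
    using e assms by (simp add: field_simps)
  with d show ?thesis by (metis DERIV_deriv_iff_real_differentiable)
qed

text \<open>
  An antiderivative turns integrals of \<^const>\<open>dickman\<close> over \<open>[a,b]\<close> into differences, so that
  monotonicity and mean value arguments replace integral estimates.
\<close>

definition dickman_primitive :: "real \<Rightarrow> real" where
  "dickman_primitive x = integral {0..x} dickman"

lemma dickman_primitive_has_derivative:
  assumes "x > 0"
  shows "(dickman_primitive has_real_derivative dickman x) (at x)"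
proof -
  have "((\<lambda>x. integral {0..x} dickman) has_real_derivative dickman x) (at x within {0..x + 1})"
    by (rule integral_has_real_derivative[OF continuous_on_dickman]) (use assms in auto)
  moreover have "at x within {0..x + 1} = at x"
    using assms by (intro at_within_interior) auto
  ultimately show ?thesis unfolding dickman_primitive_def by simp
qed

lemma continuous_on_dickman_primitive:
  assumes "0 \<le> a"
  shows "continuous_on {a..b} dickman_primitive"
proof -
  have "continuous_on {0..b} (\<lambda>x. integral {0..x} dickman)"
    by (intro indefinite_integral_continuous_1 integrable_continuous_interval
        continuous_on_dickman) auto
  with assms show ?thesis unfolding dickman_primitive_def
    by (auto intro: continuous_on_subset)
qed

text \<open>
  By the delay equation both sides have derivative \<open>dickman x - dickman (x - 1)\<close> for \<open>x > 1\<close>, and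
  both equal 1 at \<open>x = 1\<close>.
\<close>

lemma dickman_delay_integral:
  assumes "x \<ge> 1"
  shows "x * dickman x = dickman_primitive x - dickman_primitive (x - 1)"
proof -
  let ?g = "\<lambda>x. x * dickman x - dickman_primitive x + dickman_primitive (x - 1)"
  have c: "continuous_on {1..x} ?g"
    by (intro continuous_intros continuous_on_dickman continuous_on_dickman_primitive
        continuous_on_compose2[OF continuous_on_dickman_primitive[of 0 x]]) auto
  have "?g x = ?g 1"
  proof (cases "x = 1")
    case False
    with assms have "1 < x" by simp
    then show ?thesis
    proof (rule DERIV_isconst_end[OF _ c])
      fix y :: real assume y: "1 < y" "y < x"
      have "((\<lambda>x. dickman_primitive (x - 1)) has_real_derivative dickman (y - 1)) (at y)"
        using DERIV_shift[of dickman_primitive "dickman (y - 1)" y "- 1"]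
          dickman_primitive_has_derivative[of "y - 1"] y by simp
      with y show "(?g has_real_derivative 0) (at y)"
        by (auto intro!: derivative_eq_intros dickman_has_derivative
              dickman_primitive_has_derivative)
    qed
  qed simp
  also have "?g 1 = 0"
  proof -
    have "dickman_primitive 1 = integral {0..1} (\<lambda>x::real. 1::real)"
      unfolding dickman_primitive_def by (intro integral_cong) (simp add: dickman_eq_1)
    then show ?thesis by (simp add: dickman_eq_1) (simp add: dickman_primitive_def)
  qed
  finally show ?thesis by simp
qed

text \<open>
  At the first point \<open>z\<close> where the function is not positive, the integral of a positive function over \<open>[z-1,z]\<close> would be
  \<open>z * dickman z \<le> 0\<close>.
\<close>

lemma dickman_pos:
  assumes "x \<ge> 0"
  shows "dickman x > 0"
proof (rule ccontr)
  assume neg: "\<not> dickman x > 0"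
  let ?Z = "{y \<in> {0..x}. dickman y \<le> 0}"
  have "closed ?Z"
    using continuous_closed_preimage[of "{0..x}" dickman "{..0}"]
    by (simp add: continuous_on_dickman vimage_def Int_def conj_assoc)
  then have "compact ({0..x} \<inter> ?Z)"
    by (rule compact_Int_closed[OF compact_Icc])
  then have "compact ?Z"
    by (simp add: Int_def conj_ac cong: conj_cong)
  then obtain z where z: "z \<in> ?Z" and min: "\<And>y. y \<in> ?Z \<Longrightarrow> z \<le> y"
    using compact_attains_inf[of ?Z] neg assms by fastforce
  have z1: "z > 1" using z dickman_eq_1[of z] by force
  have pos: "dickman y > 0" if "0 \<le> y" "y < z" for y
    using min[of y] that z by force
  have "dickman_primitive (z - 1) < dickman_primitive z"
  proof (rule DERIV_pos_imp_increasing_open[where f = dickman_primitive])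
    show "\<exists>d. (dickman_primitive has_real_derivative d) (at y) \<and> 0 < d" if "z - 1 < y" "y < z" for y
      using dickman_primitive_has_derivative[of y] pos[of y] that z1
      by (intro exI[of _ "dickman y"]) auto
  qed (use z1 in \<open>auto intro!: continuous_on_dickman_primitive\<close>)
  then have "0 < z * dickman z" using dickman_delay_integral[of z] z1 by simp
  with z z1 show False by (simp add: zero_less_mult_iff)
qed

lemma dickman_antimono:
  assumes "0 \<le> a" "a \<le> b"
  shows "dickman b \<le> dickman a"
proof -
  have *: "dickman b \<le> dickman a" if "1 \<le> a" "a \<le> b" for a b
  proof -
    have "- dickman a \<le> - dickman b"
    proof (rule DERIV_nonneg_imp_increasing_open[OF that(2)])
      fix x assume x: "a < x" "x < b"
      then have "((\<lambda>v. - dickman v) has_real_derivative (dickman (x - 1) / x)) (at x)"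
        using DERIV_minus[OF dickman_has_derivative[of x]] that by simp
      then show "\<exists>y. ((\<lambda>v. - dickman v) has_real_derivative y) (at x) \<and> 0 \<le> y"
        using dickman_pos[of "x - 1"] x that by (intro exI conjI) auto
    qed (use that in \<open>auto intro!: continuous_intros continuous_on_dickman\<close>)
    then show ?thesis by simp
  qed
  show ?thesis
    using *[of a b] *[of 1 b] dickman_eq_1[of a] dickman_eq_1[of b] dickman_eq_1[of 1] assms
    by (cases "a \<le> 1"; cases "b \<le> 1") auto
qed

section \<open>Decay rate of the Dickman function\<close>

text \<open>
  A bound \<open>K\<close> for the logarithmic derivative on \<open>[0,T]\<close>, here in integrated form, keeps the function
  above \<open>dickman (t-1) * exp (-K (y - (t-1)))\<close> for \<open>y \<in> [t-1,t-1/2]\<close>. Integrating this over that half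
  of \<open>[t-1,t]\<close> bounds \<open>t * dickman t\<close> from below. Only half of the interval is used, so that \<open>t\<close> may
  exceed \<open>T\<close> by \<open>1/2\<close>.
\<close>

lemma dickman_delay_bound:
  assumes "K > 0" "T \<ge> 1"
    and decay: "\<And>a b. 0 \<le> a \<Longrightarrow> a \<le> b \<Longrightarrow> b \<le> T \<Longrightarrow> dickman a \<le> dickman b * exp (K * (b - a))"
    and t: "1 \<le> t" "t \<le> T + 1/2"
  shows "dickman (t - 1) * (1 - exp (- K / 2)) \<le> K * (t * dickman t)"
proof -
  (* The second summand is an antiderivative of minus the exponential lower bound. *)
  let ?g = "\<lambda>y. dickman_primitive y + dickman (t - 1) * exp (- K * (y - (t - 1))) / K"
  have "?g (t - 1) \<le> ?g (t - 1/2)"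
  proof (rule DERIV_nonneg_imp_increasing_open[where f = ?g])
    fix y assume y: "t - 1 < y" "y < t - 1/2"
    have "dickman (t - 1) \<le> dickman y * exp (K * (y - (t - 1)))"
      using decay[of "t - 1" y] y t by simp
    then have "dickman (t - 1) * exp (- K * (y - (t - 1))) \<le> dickman y"
      by (simp add: exp_minus divide_simps mult.commute)
    moreover have "(?g has_real_derivative
        (dickman y - dickman (t - 1) * exp (- K * (y - (t - 1))))) (at y)"
      using y t \<open>K > 0\<close>
      by (auto intro!: derivative_eq_intros dickman_primitive_has_derivative)
    ultimately show "\<exists>d. (?g has_real_derivative d) (at y) \<and> 0 \<le> d"
      by (intro exI conjI) auto
  qed (use t \<open>K > 0\<close> in \<open>auto intro!: continuous_intros continuous_on_dickman_primitive\<close>)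
  then have "dickman (t - 1) * (1 - exp (- K / 2)) / K
      \<le> dickman_primitive (t - 1/2) - dickman_primitive (t - 1)"
    by (simp add: right_diff_distrib diff_divide_distrib)
  also have "dickman_primitive (t - 1/2) \<le> dickman_primitive t"
  proof (rule DERIV_nonneg_imp_increasing_open[where f = dickman_primitive])
    show "\<exists>d. (dickman_primitive has_real_derivative d) (at y) \<and> 0 \<le> d"
      if "t - 1/2 < y" "y < t" for y
      using dickman_primitive_has_derivative[of y] dickman_pos[of y] that t
      by (intro exI[of _ "dickman y"]) auto
  qed (use t in \<open>auto intro!: continuous_on_dickman_primitive\<close>)
  finally have "dickman (t - 1) * (1 - exp (- K / 2)) / K \<le> t * dickman t"
    using dickman_delay_integral[of t] t by simp
  then show ?thesis using \<open>K > 0\<close> by (simp add: field_simps)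
qed

text \<open>
  The preceding bound says that \<open>-dickman' \<le> K' * dickman\<close> on \<open>[1,T+1/2]\<close>, so
  \<open>dickman y * exp (K' y)\<close> is nondecreasing there. On \<open>[0,1]\<close> the function is constant, and intervals
  starting in \<open>[0,1]\<close> reduce to intervals starting at 1.
\<close>

lemma dickman_decay_extend:
  assumes "K > 0" "T \<ge> 1"
    and decay: "\<And>a b. 0 \<le> a \<Longrightarrow> a \<le> b \<Longrightarrow> b \<le> T \<Longrightarrow> dickman a \<le> dickman b * exp (K * (b - a))"
    and K': "K \<le> K' * (1 - exp (- K / 2))"
    and ab: "0 \<le> a" "a \<le> b" "b \<le> T + 1/2"
  shows "dickman a \<le> dickman b * exp (K' * (b - a))"
proof -
  have e: "1 - exp (- K / 2) > 0" using \<open>K > 0\<close> by simp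
  with K' \<open>K > 0\<close> have "K' > 0" by (smt (verit) mult_nonpos_nonneg)
  have *: "dickman a * exp (K' * a) \<le> dickman b * exp (K' * b)"
    if "1 \<le> a" "a \<le> b" "b \<le> T + 1/2" for a b
  proof (rule DERIV_nonneg_imp_increasing_open[OF that(2)])
    fix y assume y: "a < y" "y < b"
    have "dickman (y - 1) * (1 - exp (- K / 2)) \<le> K * (y * dickman y)"
      by (rule dickman_delay_bound[OF assms(1,2) decay]) (use y that in auto)
    also have "\<dots> \<le> K' * (1 - exp (- K / 2)) * (y * dickman y)"
      using K' y that dickman_pos[of y] by (intro mult_right_mono) auto
    finally have "dickman (y - 1) \<le> K' * (y * dickman y)"
      using e by (simp add: mult.assoc mult.left_commute)
    then have "0 \<le> K' * dickman y - dickman (y - 1) / y"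
      using y that by (simp add: field_simps)
    moreover have "((\<lambda>y. dickman y * exp (K' * y)) has_real_derivative
        ((K' * dickman y - dickman (y - 1) / y) * exp (K' * y))) (at y)"
      using y that
      by (auto intro!: derivative_eq_intros dickman_has_derivative simp: algebra_simps)
    ultimately show "\<exists>d. ((\<lambda>y. dickman y * exp (K' * y)) has_real_derivative d) (at y) \<and> 0 \<le> d"
      by (intro exI conjI) auto
  qed (use that in \<open>auto intro!: continuous_intros continuous_on_dickman\<close>)
  show ?thesis
  proof (cases "b \<le> 1")
    case True
    then show ?thesis using ab \<open>K' > 0\<close> by (simp add: dickman_eq_1)
  next
    case False
    define a' where "a' = max a 1"
    have "dickman a = dickman a'"
      using ab by (auto simp: a'_def max_def dickman_eq_1)
    also have "dickman a' * exp (K' * a') \<le> dickman b * exp (K' * b)"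
      using *[of a' b] False ab by (auto simp: a'_def)
    then have "dickman a' \<le> dickman b * exp (K' * (b - a'))"
      by (simp add: right_diff_distrib exp_diff field_simps)
    also have "\<dots> \<le> dickman b * exp (K' * (b - a))"
      using dickman_pos[of b] ab \<open>K' > 0\<close> by (auto simp: a'_def intro!: mult_left_mono)
    finally show ?thesis .
  qed
qed

text \<open>
  The constant 4 makes \<open>exp (-K/2) = 1/x\<^sup>2\<close> for \<open>K = 4 ln x\<close>. The increment \<open>ln (x+1) - ln x\<close>, which is at
  least \<open>1/(x+1)\<close>, then dominates the loss \<open>ln (x+1) / x\<^sup>2\<close> of one step as soon as \<open>x \<ge> 3\<close>; hence the
  shift by 3.
\<close>

lemma dickman_decay_half_steps:
  assumes "0 \<le> a" "a \<le> b" "b \<le> 1 + real i / 2"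
  shows "dickman a \<le> dickman b * exp (4 * ln (real i + 3) * (b - a))"
  using assms
proof (induction i arbitrary: a b)
  case 0
  then show ?case by (simp add: dickman_eq_1)
next
  case (Suc i)
  define x where "x = real i + 3"
  have x: "x \<ge> 3" by (simp add: x_def)
  have step: "4 * ln x \<le> 4 * ln (x + 1) * (1 - exp (- (4 * ln x) / 2))"
  proof -
    have "exp (- (4 * ln x) / 2) = 1 / x\<^sup>2"
    proof -
      have "exp (- (4 * ln x) / 2) = inverse (exp (ln x + ln x))" by (simp add: exp_minus)
      also have "\<dots> = 1 / x\<^sup>2"
        using x by (simp only: exp_add) (simp add: power2_eq_square field_simps)
      finally show ?thesis .
    qed
    moreover have "ln (x + 1) / x\<^sup>2 \<le> ln (x + 1) - ln x"
    proof -
      have "ln ((x + 1) / 2) \<le> (x + 1) / 2 - 1" using x by (intro ln_le_minus_one) auto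
      moreover have "ln (2::real) \<le> 1" using ln_le_minus_one[of "2::real"] by simp
      ultimately have "ln (x + 1) \<le> (x + 1) / 2" using x by (simp add: ln_div)
      also have "\<dots> \<le> x - 1" using x by simp
      also have "x - 1 \<le> x\<^sup>2 / (x + 1)" using x by (simp add: field_simps power2_eq_square)
      finally have "ln (x + 1) / x\<^sup>2 \<le> 1 / (x + 1)" using x by (simp add: field_simps)
      also have "\<dots> \<le> ln (x + 1) - ln x"
      proof -
        have "ln (x / (x + 1)) \<le> x / (x + 1) - 1" using x by (intro ln_le_minus_one) auto
        then have "ln x - ln (x + 1) \<le> x / (x + 1) - 1" using x by (simp add: ln_div)
        moreover have "x / (x + 1) - 1 = - (1 / (x + 1))" using x by (simp add: field_simps)
        ultimately show ?thesis by simp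
      qed
      finally show ?thesis .
    qed
    ultimately show ?thesis by (simp add: right_diff_distrib)
  qed
  have "dickman a \<le> dickman b * exp (4 * ln (x + 1) * (b - a))"
  proof (rule dickman_decay_extend[OF _ _ _ step Suc.prems(1,2)])
    show "dickman a \<le> dickman b * exp (4 * ln x * (b - a))"
      if "0 \<le> a" "a \<le> b" "b \<le> 1 + real i / 2" for a b
      using Suc.IH[OF that] by (simp add: x_def)
  qed (use x Suc.prems in \<open>auto simp: field_simps\<close>)
  then show ?case by (simp add: x_def add_ac)
qed

lemma dickman_decay:
  assumes "0 \<le> a" "a \<le> u" "1 \<le> u"
  shows "dickman a \<le> dickman u * exp (8 * ln (u + 1) * (u - a))"
proof -
  (* the number of half steps that lead from 1 to u *)
  define i where "i = nat \<lceil>2 * u - 2\<rceil>"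
  have i: "2 * u - 2 \<le> real i" "real i \<le> 2 * u - 1" using assms by (auto simp: i_def) linarith+
  have "ln (real i + 3) \<le> ln ((u + 1) * (u + 1))"
  proof -
    have "real i + 3 \<le> 2 * (u + 1)" using i by simp
    also have "\<dots> \<le> (u + 1) * (u + 1)" using assms by (intro mult_right_mono) auto
    finally show ?thesis by (subst ln_le_cancel_iff) (use assms in auto)
  qed
  also have "\<dots> = 2 * ln (u + 1)" using assms by (subst ln_mult) auto
  finally have "4 * ln (real i + 3) * (u - a) \<le> 8 * ln (u + 1) * (u - a)"
    using assms by (intro mult_right_mono) auto
  then have "dickman u * exp (4 * ln (real i + 3) * (u - a)) \<le> dickman u * exp (8 * ln (u + 1) * (u - a))"
    using dickman_pos[of u] assms by (intro mult_left_mono) auto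
  with dickman_decay_half_steps[of a u i] i assms show ?thesis by simp
qed

section \<open>Riemann sums of the Dickman function\<close>

text \<open>
  The middle term is \<open>s\<close> times the integral over \<open>[m/s-1,m/s]\<close>. On each of the \<open>s\<close> subintervals of length
  \<open>1/s\<close> the function lies between its values at the right and at the left endpoint.
\<close>

lemma dickman_riemann_sum:
  fixes s m :: nat
  assumes "0 < s" "s \<le> m"
  shows "(\<Sum>j<s. dickman ((real m - real j) / real s)) \<le> real m * dickman (real m / real s)"
    and "real m * dickman (real m / real s) \<le> (\<Sum>j<s. dickman ((real m - real (Suc j)) / real s))"
proof -
  define x where "x j = (real m - real j) / real s" for j
  have x: "0 \<le> x (Suc j)" "x (Suc j) < x j" "x j - x (Suc j) = 1 / real s" if "j < s" for j
    using that assms by (auto simp: x_def divide_strict_right_mono simp flip: diff_divide_distrib)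
  have b: "dickman (x j) \<le> real s * (dickman_primitive (x j) - dickman_primitive (x (Suc j))) \<and>
           real s * (dickman_primitive (x j) - dickman_primitive (x (Suc j))) \<le> dickman (x (Suc j))"
    if "j < s" for j
  proof -
    have "\<exists>l z. x (Suc j) < z \<and> z < x j \<and> DERIV dickman_primitive z :> l \<and>
        dickman_primitive (x j) - dickman_primitive (x (Suc j)) = (x j - x (Suc j)) * l"
    proof (rule MVT)
      show "dickman_primitive differentiable (at y)" if "x (Suc j) < y" "y < x j" for y
        using dickman_primitive_has_derivative[of y] x[OF \<open>j < s\<close>] that
        by (auto simp: real_differentiable_def)
    qed (use x[OF that] in \<open>auto intro: continuous_on_dickman_primitive\<close>)
    then obtain l z where z: "x (Suc j) < z" "z < x j" "DERIV dickman_primitive z :> l"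
      "dickman_primitive (x j) - dickman_primitive (x (Suc j)) = (x j - x (Suc j)) * l"
      by blast
    have "l = dickman z"
      using DERIV_unique[OF z(3) dickman_primitive_has_derivative] x[OF that] z by auto
    with z x[OF that] assms have "real s * (dickman_primitive (x j) - dickman_primitive (x (Suc j))) = dickman z"
      by simp
    then show ?thesis
      using dickman_antimono[of z "x j"] dickman_antimono[of "x (Suc j)" z] z x[OF that] by simp
  qed
  have x0: "x 0 = real m / real s" and xs: "x s = real m / real s - 1"
    using assms by (auto simp: x_def diff_divide_distrib)
  have "real m * dickman (real m / real s) = real s * (real m / real s * dickman (real m / real s))"
    using assms by simp
  also have "\<dots> = real s * (dickman_primitive (x 0) - dickman_primitive (x s))"
    unfolding x0 xs by (subst dickman_delay_integral) (use assms in auto)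
  also have "\<dots> = (\<Sum>j<s. real s * (dickman_primitive (x j) - dickman_primitive (x (Suc j))))"
    by (subst sum_lessThan_telescope'[of "\<lambda>j. dickman_primitive (x j)" s, symmetric])
      (simp add: sum_distrib_left)
  finally have *: "real m * dickman (real m / real s) =
    (\<Sum>j<s. real s * (dickman_primitive (x j) - dickman_primitive (x (Suc j))))" .
  show "(\<Sum>j<s. dickman ((real m - real j) / real s)) \<le> real m * dickman (real m / real s)"
    unfolding * by (intro sum_mono) (use b in \<open>auto simp: x_def\<close>)
  show "real m * dickman (real m / real s) \<le> (\<Sum>j<s. dickman ((real m - real (Suc j)) / real s))"
    unfolding * by (intro sum_mono) (use b in \<open>auto simp: x_def\<close>)
qed

section \<open>Splitting off the cycle through a point\<close>

text \<open>
  The cycle condition is put on the orbit of each point instead of on the number of cycles of each length,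
  and the ground set is arbitrary, because removing a cycle from \<open>{1..n}\<close> need not leave an initial segment.
\<close>

definition short_cycle_perms :: "nat \<Rightarrow> 'a set \<Rightarrow> ('a \<Rightarrow> 'a) set" where
  "short_cycle_perms r S = {\<sigma>. \<sigma> permutes S \<and> (\<forall>x\<in>S. card (orbit \<sigma> x) \<le> r)}"

lemma finite_short_cycle_perms: "finite S \<Longrightarrow> finite (short_cycle_perms r S)"
  by (rule finite_subset[OF _ finite_permutations[of S]]) (auto simp: short_cycle_perms_def)

lemma nu_eq_card_short_cycle_perms:
  "\<nu> n r = real (card (short_cycle_perms r {1..n})) / fact n"
proof -
  have "(\<forall>j\<in>{r+1..n}. cycle_count n j \<sigma> = 0) \<longleftrightarrow> (\<forall>x\<in>{1..n}. card (orbit \<sigma> x) \<le> r)"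
    if "\<sigma> permutes {1..n}" for \<sigma>
  proof -
    have "card (orbit \<sigma> x) \<le> n" if "x \<in> {1..n}" for x
      using card_mono[OF _ permutes_orbit_subset[OF \<open>\<sigma> permutes {1..n}\<close> that]] by simp
    moreover have "cycle_count n j \<sigma> = 0 \<longleftrightarrow> (\<forall>x\<in>{1..n}. card (orbit \<sigma> x) \<noteq> j)" for j
      unfolding cycle_count_def by (subst card_0_eq) auto
    ultimately show ?thesis by (metis Suc_eq_plus1 atLeastAtMost_iff not_less_eq_eq)
  qed
  then show ?thesis
    by (auto simp: \<nu>_def short_cycle_perms_def intro!: arg_cong[where f = card])
qed

lemma funpow_cycle_of_list:
  assumes "distinct c" "c \<noteq> []"
  shows "(cycle_of_list c ^^ i) (hd c) = c ! (i mod length c)"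
proof -
  have pos: "0 < length c" using assms(2) by simp
  have "(cycle_of_list c ^^ i) (hd c) = (cycle_of_list c ^^ i) (c ! 0)"
    by (simp only: hd_conv_nth[OF assms(2)])
  also have "\<dots> = map (cycle_of_list c ^^ i) c ! 0"
    by (rule nth_map[OF pos, symmetric])
  also have "\<dots> = rotate i c ! 0" by (simp only: cyclic_rotation[OF assms(1)])
  also have "\<dots> = c ! (i mod length c)"
    by (simp only: nth_rotate[OF pos] add_0_right)
  finally show ?thesis .
qed

lemma orbit_cycle_of_list:
  assumes "distinct c" "c \<noteq> []"
  shows "orbit (cycle_of_list c) (hd c) = set c"
proof -
  have "orbit (cycle_of_list c) (hd c) = range (\<lambda>i. (cycle_of_list c ^^ i) (hd c))"
    unfolding orbit_altdef_permutation[OF permutation_of_cycle] by auto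
  also have "\<dots> = range (\<lambda>i. c ! (i mod length c))"
    by (simp only: funpow_cycle_of_list[OF assms])
  also have "\<dots> = set c"
  proof (intro equalityI subsetI)
    fix y assume "y \<in> set c"
    then obtain i where "i < length c" "y = c ! i" by (metis in_set_conv_nth)
    then have "y = c ! (i mod length c)" by simp
    then show "y \<in> range (\<lambda>i. c ! (i mod length c))" by blast
  next
    fix y assume "y \<in> range (\<lambda>i. c ! (i mod length c))"
    then show "y \<in> set c" using assms(2) by auto
  qed
  finally show ?thesis .
qed

text \<open>
  In this context \<open>\<tau> \<circ> cycle_of_list c\<close> glues the cycle \<open>c\<close> to a permutation \<open>\<tau>\<close> of the remaining points.
  The facts below say that its orbits are \<open>set c\<close> and the orbits of \<open>\<tau>\<close>, and that \<open>c\<close> and \<open>\<tau>\<close> can be read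
  off from it.
\<close>

context
  fixes S :: "'a set" and c :: "'a list" and \<tau> :: "'a \<Rightarrow> 'a"
  assumes finS: "finite S" and dist: "distinct c" and ne: "c \<noteq> []"
    and sub: "set c \<subseteq> S" and tau: "\<tau> permutes S - set c"
begin

lemma comp_cycle_in:
  assumes "y \<in> set c"
  shows "(\<tau> \<circ> cycle_of_list c) y = cycle_of_list c y"
proof -
  have "cycle_of_list c y \<in> set c"
    using permutes_in_image[OF cycle_permutes[of c]] assms by blast
  then show ?thesis using permutes_not_in[OF tau] by simp
qed

lemma comp_cycle_out: "y \<notin> set c \<Longrightarrow> (\<tau> \<circ> cycle_of_list c) y = \<tau> y"
  by (simp add: id_outside_supp)

lemma comp_cycle_permutes: "\<tau> \<circ> cycle_of_list c permutes S"
  by (rule permutes_compose[OF permutes_subset[OF cycle_permutes sub]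
        permutes_subset[OF tau Diff_subset]])

lemma orbit_comp_cycle:
  assumes "y \<in> set c"
  shows "orbit (\<tau> \<circ> cycle_of_list c) y = set c"
proof -
  have "orbit (cycle_of_list c) (hd c) = orbit (\<tau> \<circ> cycle_of_list c) (hd c)"
  proof (rule orbit_cong0[of _ "set c"])
    show "cycle_of_list c \<in> set c \<rightarrow> set c"
      using permutes_in_image[OF cycle_permutes[of c]] by blast
  qed (use ne comp_cycle_in in auto)
  then have *: "orbit (\<tau> \<circ> cycle_of_list c) (hd c) = set c"
    using orbit_cycle_of_list[OF dist ne] by simp
  have "cyclic_on (\<tau> \<circ> cycle_of_list c) (set c)"
    using cyclic_on_orbit[OF comp_cycle_permutes finS, of "hd c"] unfolding * .
  then show ?thesis using assms by (rule orbit_cyclic_eq3)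
qed

lemma orbit_comp_cycle_other:
  assumes "y \<in> S - set c"
  shows "orbit (\<tau> \<circ> cycle_of_list c) y = orbit \<tau> y"
proof -
  have "orbit \<tau> y = orbit (\<tau> \<circ> cycle_of_list c) y"
  proof (rule orbit_cong0[of _ "S - set c"])
    show "\<tau> \<in> S - set c \<rightarrow> S - set c"
      using permutes_in_image[OF tau] by blast
  qed (use assms comp_cycle_out in auto)
  then show ?thesis by simp
qed

lemma funpow_comp_cycle:
  "((\<tau> \<circ> cycle_of_list c) ^^ i) (hd c) = c ! (i mod length c)"
proof (induction i)
  case 0
  show ?case by (simp only: funpow_0 hd_conv_nth[OF ne] mod_0)
next
  case (Suc i)
  have "((\<tau> \<circ> cycle_of_list c) ^^ Suc i) (hd c) = (\<tau> \<circ> cycle_of_list c) (c ! (i mod length c))"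
    by (simp only: Suc funpow.simps o_apply[of "\<tau> \<circ> cycle_of_list c"])
  also have "\<dots> = cycle_of_list c (c ! (i mod length c))"
    by (rule comp_cycle_in) (use ne in simp)
  also have "\<dots> = (cycle_of_list c ^^ Suc i) (hd c)"
    by (simp only: funpow_cycle_of_list[OF dist ne, symmetric] funpow.simps o_apply)
  finally show ?case by (simp only: funpow_cycle_of_list[OF dist ne])
qed

end

text \<open>
  Writing the cycle through \<open>x\<close> as a list beginning with \<open>x\<close> removes the ambiguity of its starting point, so
  that a permutation corresponds to exactly one pair of a list and a permutation of the other points. The
  list \<open>xs\<close> omits \<open>x\<close>; hence the strict bound on its length.
\<close>

lemma bij_betw_split_cycle:
  assumes "finite S" "x \<in> S"
  shows "bij_betw (\<lambda>(xs, \<tau>). \<tau> \<circ> cycle_of_list (x # xs))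
    (SIGMA xs : {xs. distinct xs \<and> set xs \<subseteq> S - {x} \<and> length xs < r}.
       short_cycle_perms r (S - set (x # xs)))
    (short_cycle_perms r S)"
    (is "bij_betw ?f ?D _")
proof (rule bij_betwI')
  fix p q assume "p \<in> ?D" "q \<in> ?D"
  obtain c \<tau> where p: "p = (tl c, \<tau>)" and cx: "x # tl c = c" "hd c = x"
    and c: "distinct c" "c \<noteq> []" "set c \<subseteq> S" "\<tau> permutes S - set c"
    by (rule that[of "x # fst p" "snd p"])
       (use \<open>p \<in> ?D\<close> assms(2) in \<open>auto simp: short_cycle_perms_def\<close>)
  obtain d \<upsilon> where q: "q = (tl d, \<upsilon>)" and dx: "x # tl d = d" "hd d = x"
    and d: "distinct d" "d \<noteq> []" "set d \<subseteq> S" "\<upsilon> permutes S - set d"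
    by (rule that[of "x # fst q" "snd q"])
       (use \<open>q \<in> ?D\<close> assms(2) in \<open>auto simp: short_cycle_perms_def\<close>)
  show "(?f p = ?f q) = (p = q)"
  proof
    assume "?f p = ?f q"
    then have eq: "\<tau> \<circ> cycle_of_list c = \<upsilon> \<circ> cycle_of_list d"
      by (simp only: p q cx dx prod.case)
    have "x \<in> set c" "x \<in> set d" using hd_in_set[OF c(2)] hd_in_set[OF d(2)] cx dx by auto
    then have set: "set c = set d"
      using orbit_comp_cycle[OF assms(1) c, of x] orbit_comp_cycle[OF assms(1) d, of x]
      by (simp only: eq)
    have len: "length c = length d"
      by (simp only: set distinct_card[OF c(1), symmetric] distinct_card[OF d(1), symmetric])
    have list: "c = d"
    proof (rule nth_equalityI[OF len])
      fix i assume i: "i < length c"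
      have "c ! i = ((\<upsilon> \<circ> cycle_of_list d) ^^ i) x"
        using funpow_comp_cycle[OF assms(1) c, of i] i by (simp only: eq cx mod_less)
      also have "\<dots> = d ! i"
        using funpow_comp_cycle[OF assms(1) d, of i] i by (simp only: dx len mod_less)
      finally show "c ! i = d ! i" .
    qed
    have "\<tau> y = \<upsilon> y" for y
    proof (cases "y \<in> set c")
      case True
      then show ?thesis
        using permutes_not_in[OF c(4), of y] permutes_not_in[OF d(4), of y] set by simp
    next
      case False
      have "\<tau> y = (\<upsilon> \<circ> cycle_of_list d) y"
        using comp_cycle_out[OF assms(1) c False] by (simp only: eq)
      also have "\<dots> = \<upsilon> y"
        by (rule comp_cycle_out[OF assms(1) d]) (use False set in blast)
      finally show ?thesis .
    qed
    then have "\<tau> = \<upsilon>" by blast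
    with list show "p = q" by (simp only: p q)
  qed simp
next
  fix p assume "p \<in> ?D"
  then obtain c \<tau> where p: "p = (tl c, \<tau>)" "x # tl c = c" and r: "length c \<le> r"
    and c: "distinct c" "c \<noteq> []" "set c \<subseteq> S" "\<tau> permutes S - set c"
    and short: "\<And>y. y \<in> S - set c \<Longrightarrow> card (orbit \<tau> y) \<le> r"
    by (intro that[of "x # fst p" "snd p"]) (use assms(2) in \<open>auto simp: short_cycle_perms_def\<close>)
  have "card (orbit (\<tau> \<circ> cycle_of_list c) y) \<le> r" if "y \<in> S" for y
  proof (cases "y \<in> set c")
    case True
    then show ?thesis
      using orbit_comp_cycle[OF assms(1) c True] distinct_card[OF c(1)] r by simp
  next
    case False
    then show ?thesis
      using orbit_comp_cycle_other[OF assms(1) c, of y] short[of y] that by simp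
  qed
  then show "?f p \<in> short_cycle_perms r S"
    using comp_cycle_permutes[OF assms(1) c] by (simp add: p short_cycle_perms_def)
next
  fix \<sigma> assume "\<sigma> \<in> short_cycle_perms r S"
  then have \<sigma>: "\<sigma> permutes S" and short: "\<And>y. y \<in> S \<Longrightarrow> card (orbit \<sigma> y) \<le> r"
    by (auto simp: short_cycle_perms_def)
  have perm: "permutation \<sigma>" using \<sigma> assms(1) by (auto simp: permutation_permutes)
  define c where "c = support \<sigma> x"
  have set_c: "set c = orbit \<sigma> x"
    unfolding c_def support_set[OF perm] orbit_altdef_permutation[OF perm] by auto
  have dist: "distinct c" unfolding c_def by (rule cycle_of_permutation[OF perm])
  have "c \<noteq> [] \<and> hd c = x"
    using least_power_of_permutation(2)[OF perm, of x] by (simp add: c_def hd_map)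
  then obtain xs where xs: "c = x # xs" by (cases c) auto
  have sub: "set c \<subseteq> S" using permutes_orbit_subset[OF \<sigma> assms(2)] set_c by simp
  define \<tau> where "\<tau> = perm_restrict \<sigma> (S - set c)"
  have \<tau>: "\<tau> permutes S - set c"
    unfolding \<tau>_def set_c by (intro perm_restrict_diff_cyclic[OF \<sigma>] cyclic_on_orbit[OF \<sigma> assms(1)])
  have eq: "\<sigma> = \<tau> \<circ> cycle_of_list c"
  proof
    fix y
    show "\<sigma> y = (\<tau> \<circ> cycle_of_list c) y"
    proof (cases "y \<in> set c")
      case True
      then have "\<sigma> y = cycle_of_list c y" unfolding c_def by (rule cycle_restrict[OF perm])
      moreover have "cycle_of_list c y \<in> set c"
        using True permutes_in_image[OF cycle_permutes] by metis
      ultimately show ?thesis by (simp add: \<tau>_def perm_restrict_def)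
    next
      case False
      then have "(\<tau> \<circ> cycle_of_list c) y = \<tau> y" by (simp add: id_outside_supp)
      also have "\<dots> = \<sigma> y" using False permutes_not_in[OF \<sigma>] by (auto simp: \<tau>_def perm_restrict_def)
      finally show ?thesis by simp
    qed
  qed
  have "card (orbit \<tau> y) \<le> r" if y: "y \<in> S - set (x # xs)" for y
    using orbit_comp_cycle_other[OF assms(1) dist _ sub \<tau>, of y] short[of y] y xs eq by simp
  moreover have "length xs < r"
    using short[OF assms(2)] distinct_card[OF dist] set_c xs by simp
  ultimately have "(xs, \<tau>) \<in> ?D"
    using dist sub \<tau> by (auto simp: short_cycle_perms_def xs)
  moreover have "\<sigma> = ?f (xs, \<tau>)" using eq by (simp add: xs)
  ultimately show "\<exists>p\<in>?D. \<sigma> = ?f p" by blast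
qed

section \<open>The recurrence\<close>

lemma card_distinct_lists:
  assumes "finite A" "k \<le> card A"
  shows "real (card {xs. length xs = k \<and> distinct xs \<and> set xs \<subseteq> A}) = fact (card A) / fact (card A - k)"
proof -
  have "(\<Prod>{card A - k + 1..card A}) = (fact (card A) div fact (card A - k) :: nat)"
    using assms(2) by (simp add: fact_div_fact)
  then show ?thesis
    using card_lists_distinct_length_eq[OF assms] fact_dvd[of "card A - k" "card A", where 'a = nat]
    by (simp add: real_of_nat_div)
qed

lemma card_short_cycle_perms_split:
  assumes "finite S" "x \<in> S"
  shows "card (short_cycle_perms r S) = (\<Sum>xs | distinct xs \<and> set xs \<subseteq> S - {x} \<and> length xs < r.
           card (short_cycle_perms r (S - set (x # xs))))"
proof -
  have "finite {xs. distinct xs \<and> set xs \<subseteq> S - {x} \<and> length xs < r}"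
    by (rule finite_subset[OF _ finite_subset_distinct[of "S - {x}"]]) (use assms in auto)
  then show ?thesis
    using bij_betw_same_card[OF bij_betw_split_cycle[OF assms, of r]] assms
    by (simp add: card_SigmaI finite_short_cycle_perms)
qed

lemma sum_distinct_lists_by_length:
  fixes g :: "nat \<Rightarrow> real"
  assumes "finite A"
  shows "(\<Sum>xs | distinct xs \<and> set xs \<subseteq> A \<and> length xs < r. g (length xs)) =
    (\<Sum>k<min r (Suc (card A)). fact (card A) / fact (card A - k) * g k)"
proof -
  let ?L = "{xs. distinct xs \<and> set xs \<subseteq> A \<and> length xs < r}"
  have fin: "finite ?L"
    by (rule finite_subset[OF _ finite_subset_distinct[OF assms]]) auto
  have img: "length ` ?L \<subseteq> {..<min r (Suc (card A))}"
  proof clarify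
    fix xs assume "distinct xs" "set xs \<subseteq> A" "length xs < r"
    then show "length xs < min r (Suc (card A))"
      using card_mono[OF assms, of "set xs"] by (simp add: distinct_card)
  qed
  have "(\<Sum>xs\<in>?L. g (length xs)) =
      (\<Sum>k<min r (Suc (card A)). \<Sum>xs\<in>{xs \<in> ?L. length xs = k}. g (length xs))"
    by (rule sum.group[OF fin _ img, symmetric]) simp
  also have "\<dots> = (\<Sum>k<min r (Suc (card A)). fact (card A) / fact (card A - k) * g k)"
  proof (rule sum.cong[OF refl])
    fix k assume k: "k \<in> {..<min r (Suc (card A))}"
    then have "{xs \<in> ?L. length xs = k} = {xs. length xs = k \<and> distinct xs \<and> set xs \<subseteq> A}"
      by auto
    then show "(\<Sum>xs\<in>{xs \<in> ?L. length xs = k}. g (length xs)) = fact (card A) / fact (card A - k) * g k"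
      using card_distinct_lists[OF assms, of k] k by simp
  qed
  finally show ?thesis .
qed

text \<open>
  There are \<open>fact m / fact (m - k)\<close> lists of length \<open>k\<close> with \<open>m = card T - 1\<close>, and each leaves
  \<open>fact (m - k) * \<nu> (m - k) r\<close> permutations of the other points, so the factorials cancel. The step takes
  the count for smaller sets as a hypothesis because it serves both to show that the count depends only
  on the cardinality and to derive the recurrence.
\<close>

lemma card_short_cycle_perms_step:
  fixes T :: "nat set"
  assumes "finite T" "T \<noteq> {}"
    and IH: "\<And>U :: nat set. finite U \<Longrightarrow> card U < card T \<Longrightarrow>
      real (card (short_cycle_perms r U)) = fact (card U) * \<nu> (card U) r"
  shows "real (card (short_cycle_perms r T)) =
    fact (card T - 1) * (\<Sum>k<min r (card T). \<nu> (card T - Suc k) r)"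
proof -
  obtain x where x: "x \<in> T" using assms(2) by blast
  define m where "m = card T - 1"
  have m: "card (T - {x}) = m" "card T = Suc m"
    using card_Suc_Diff1[OF assms(1) x] x assms(1) by (auto simp: m_def)
  have smaller: "real (card (short_cycle_perms r (T - set (x # xs)))) =
      fact (m - length xs) * \<nu> (m - length xs) r"
    if "distinct xs" "set xs \<subseteq> T - {x}" for xs
  proof -
    have "T - set (x # xs) = (T - {x}) - set xs" by auto
    then have "card (T - set (x # xs)) = m - length xs"
      using card_Diff_subset[OF finite_set that(2)] distinct_card[OF that(1)] m by simp
    with IH[of "T - set (x # xs)"] m assms(1) show ?thesis by simp
  qed
  have "real (card (short_cycle_perms r T)) =
      (\<Sum>xs | distinct xs \<and> set xs \<subseteq> T - {x} \<and> length xs < r.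
         real (card (short_cycle_perms r (T - set (x # xs)))))"
    unfolding card_short_cycle_perms_split[OF assms(1) x] by simp
  also have "\<dots> = (\<Sum>xs | distinct xs \<and> set xs \<subseteq> T - {x} \<and> length xs < r.
      fact (m - length xs) * \<nu> (m - length xs) r)"
    by (rule sum.cong[OF refl]) (use smaller in blast)
  also have "\<dots> = (\<Sum>k<min r (Suc m). fact m / fact (m - k) * (fact (m - k) * \<nu> (m - k) r))"
    using sum_distinct_lists_by_length[of "T - {x}" "\<lambda>k. fact (m - k) * \<nu> (m - k) r" r] assms(1)
    by (simp add: m)
  also have "\<dots> = fact m * (\<Sum>k<min r (Suc m). \<nu> (m - k) r)"
    by (simp add: sum_distrib_left)
  finally show ?thesis by (simp add: m)
qed

lemma card_short_cycle_perms:
  fixes S :: "nat set"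
  assumes "finite S"
  shows "real (card (short_cycle_perms r S)) = fact (card S) * \<nu> (card S) r"
  using assms
proof (induction "card S" arbitrary: S rule: less_induct)
  case less
  show ?case
  proof (cases "S = {}")
    case True
    then show ?thesis using nu_eq_card_short_cycle_perms[of 0 r] by simp
  next
    case False
    have step: "real (card (short_cycle_perms r T)) =
        fact (card S - 1) * (\<Sum>k<min r (card S). \<nu> (card S - Suc k) r)"
      if T: "finite T" "T \<noteq> {}" "card T = card S" for T :: "nat set"
      using card_short_cycle_perms_step[OF T(1,2), of r] less.hyps unfolding T(3) by blast
    have "card S > 0" using False less.prems by (simp add: card_gt_0_iff)
    then have "real (card (short_cycle_perms r S)) = real (card (short_cycle_perms r {1..card S}))"
      using step[of S] step[of "{1..card S}"] less.prems False by simp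
    then show ?thesis using nu_eq_card_short_cycle_perms[of "card S" r] by simp
  qed
qed

lemma nu_recurrence:
  assumes "n > 0"
  shows "real n * \<nu> n r = (\<Sum>k<min r n. \<nu> (n - Suc k) r)"
proof -
  have "fact n * \<nu> n r = fact (n - 1) * (\<Sum>k<min r n. \<nu> (n - Suc k) r)"
    using card_short_cycle_perms_step[OF _ _ card_short_cycle_perms, of "{1..n}" r]
      card_short_cycle_perms[of "{1..n}" r] assms by simp
  moreover have "(fact n :: real) = fact (n - 1) * real n"
    using assms by (subst fact_reduce) auto
  ultimately show ?thesis by simp
qed

lemma nu_eq_1:
  assumes "n \<le> r"
  shows "\<nu> n r = 1"
  using assms card_permutations[of "{1..n}" n] by (simp add: \<nu>_def)

section \<open>Comparison\<close>

text \<open>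
  Left endpoints with step \<open>1/r\<close> make \<open>\<lambda>m. dickman (m / r)\<close> a subsolution of the recurrence with the same
  values for \<open>m \<le> r\<close>.
\<close>

lemma dickman_le_nu:
  assumes "r > 0"
  shows "dickman (real n / real r) \<le> \<nu> n r"
proof (induction n rule: less_induct)
  case (less n)
  show ?case
  proof (cases "n \<le> r")
    case True
    then show ?thesis using assms by (simp add: nu_eq_1 dickman_eq_1)
  next
    case False
    have "real n * dickman (real n / real r) \<le> (\<Sum>k<r. dickman ((real n - real (Suc k)) / real r))"
      by (rule dickman_riemann_sum(2)) (use assms False in auto)
    also have "\<dots> \<le> (\<Sum>k<r. \<nu> (n - Suc k) r)"
    proof (rule sum_mono)
      fix k assume "k \<in> {..<r}"
      with less.IH[of "n - Suc k"] False
      show "dickman ((real n - real (Suc k)) / real r) \<le> \<nu> (n - Suc k) r"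
        by (simp add: of_nat_diff)
    qed
    also have "\<dots> = real n * \<nu> n r"
      using nu_recurrence[of n r] False by simp
    finally show ?thesis using False by simp
  qed
qed

text \<open>
  Right endpoints with step \<open>1/(r+1)\<close> give a supersolution: the \<open>r + 1\<close> right endpoints are \<open>n/(r+1)\<close> itself
  and the \<open>r\<close> arguments that occur in the recurrence.
\<close>

lemma nu_le_dickman:
  "\<nu> n r \<le> dickman (real n / real (Suc r))"
proof (induction n rule: less_induct)
  case (less n)
  show ?case
  proof (cases "n \<le> r")
    case True
    then show ?thesis by (simp add: nu_eq_1 dickman_eq_1)
  next
    case False
    have "real n * \<nu> n r = (\<Sum>k<r. \<nu> (n - Suc k) r)"
      using nu_recurrence[of n r] False by simp
    also have "\<dots> \<le> (\<Sum>k<r. dickman ((real n - real (Suc k)) / real (Suc r)))"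
    proof (rule sum_mono)
      fix k assume "k \<in> {..<r}"
      with less.IH[of "n - Suc k"] False
      show "\<nu> (n - Suc k) r \<le> dickman ((real n - real (Suc k)) / real (Suc r))"
        by (simp add: of_nat_diff del: of_nat_Suc)
    qed
    also have "\<dots> \<le> (\<Sum>k<Suc r. dickman ((real n - real k) / real (Suc r)))"
      using dickman_pos[of "real n / real (Suc r)"]
      by (simp only: sum.lessThan_Suc_shift) simp
    also have "\<dots> \<le> real n * dickman (real n / real (Suc r))"
      by (rule dickman_riemann_sum(1)) (use False in auto)
    finally show ?thesis using False by simp
  qed
qed

text \<open>
  The left-hand side is \<open>n ln (n/r + 1) / r\<^sup>2\<close>. The hypothesis bounds \<open>n ln n\<close> by \<open>r\<^sup>2\<close>, and
  \<open>n/r + 1 \<le> n\<^sup>2\<close> unless \<open>n = 1\<close>.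
\<close>

lemma error_term_bounded:
  fixes n r :: nat
  assumes "0 < n" "0 < r" "sqrt (real n * ln (real n)) \<le> real r" "r \<le> n"
  shows "real n / real r * ln (real n / real r + 1) / real r \<le> 2"
proof (cases "n = 1")
  case True
  with assms have "r = 1" by simp
  with True show ?thesis using ln_le_minus_one[of "2::real"] by simp
next
  case False
  with assms have n: "n \<ge> 2" by simp
  then have ln_pos: "ln (real n) > 0" by simp
  have "real n * ln (real n) \<le> (real r)\<^sup>2"
    using assms(3) by (simp add: real_sqrt_le_iff' sqrt_le_D)
  moreover have "ln (real n / real r + 1) \<le> 2 * ln (real n)"
  proof -
    have "real n / real r \<le> real n" using assms by (simp add: divide_le_eq)
    moreover have "2 * real n \<le> real n * real n" using n by (intro mult_right_mono) auto
    ultimately have "real n / real r + 1 \<le> real n * real n" using n by linarith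
    then have "ln (real n / real r + 1) \<le> ln (real n * real n)"
      using n assms by (subst ln_le_cancel_iff) (auto simp: add_nonneg_pos)
    then show ?thesis using n by (simp add: ln_mult)
  qed
  ultimately have "real n * ln (real n / real r + 1) \<le> 2 * (real r)\<^sup>2"
    using mult_left_mono[of "ln (real n / real r + 1)" "2 * ln (real n)" "real n"] by simp
  then show ?thesis using assms by (simp add: field_simps power2_eq_square)
qed

theorem theorem2p3:
  shows "\<exists>C::real. \<forall>n r :: nat.
           0 < n \<longrightarrow> 0 < r \<longrightarrow> sqrt (real n * ln (real n)) \<le> real r \<longrightarrow> r \<le> n \<longrightarrow>
           (let u = real n / real r in
              \<exists>E::real. \<bar>E\<bar> \<le> C * (u * ln (u + 1) / real r) \<and> \<nu> n r = dickman u * (1 + E))"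
proof (intro exI[of _ "8 * exp 16"] allI impI)
  fix n r :: nat
  assume nr: "0 < n" "0 < r" "sqrt (real n * ln (real n)) \<le> real r" "r \<le> n"
  define u where "u = real n / real r"
  define v where "v = real n / real (Suc r)"
  define X where "X = u * ln (u + 1) / real r"
  define E where "E = \<nu> n r / dickman u - 1"
  have u: "u \<ge> 1" using nr by (simp add: u_def)
  have v: "0 \<le> v" "v \<le> u" using nr by (auto simp: u_def v_def intro!: divide_left_mono)
  have pos: "dickman u > 0" using dickman_pos[of u] u by simp
  have X: "0 \<le> X" "X \<le> 2"
    using error_term_bounded[OF nr] u nr(2) by (auto simp: X_def u_def)
  have "u - v \<le> u / real r"
  proof -
    have "u - v = u / real (Suc r)" using nr(2) by (simp add: u_def v_def field_simps)
    also have "\<dots> \<le> u / real r" using u nr(2) by (intro divide_left_mono) auto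
    finally show ?thesis .
  qed
  then have "ln (u + 1) * (u - v) \<le> X"
    using mult_left_mono[of "u - v" "u / real r" "ln (u + 1)"] u by (simp add: X_def mult.commute)
  then have "dickman u * exp (8 * ln (u + 1) * (u - v)) \<le> dickman u * exp (8 * X)"
    using pos by (intro mult_left_mono) auto
  then have upper: "\<nu> n r \<le> dickman u * exp (8 * X)"
    using nu_le_dickman[of n r] dickman_decay[OF v u] by (simp add: v_def)
  have "E \<ge> 0"
    using dickman_le_nu[OF nr(2), of n] pos by (simp add: E_def u_def)
  moreover have "E \<le> exp (8 * X) - 1"
    using upper pos by (simp add: E_def divide_le_eq mult.commute)
  moreover have "exp (8 * X) - 1 \<le> 8 * exp 16 * X"
  proof -
    (* exp y - 1 <= y exp y is 1 - y <= exp (- y) multiplied by exp y. *)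
    have "(1 - 8 * X) * exp (8 * X) \<le> exp (- (8 * X)) * exp (8 * X)"
      using exp_ge_add_one_self[of "- (8 * X)"] by (intro mult_right_mono) auto
    then have "exp (8 * X) - 1 \<le> 8 * X * exp (8 * X)"
      by (simp add: algebra_simps flip: exp_add)
    also have "\<dots> \<le> 8 * X * exp 16" using X by (intro mult_left_mono) auto
    finally show ?thesis by (simp add: mult_ac)
  qed
  ultimately have "\<bar>E\<bar> \<le> 8 * exp 16 * X" by simp
  moreover have "\<nu> n r = dickman u * (1 + E)" using pos by (simp add: E_def)
  ultimately show "let u = real n / real r in
      \<exists>E::real. \<bar>E\<bar> \<le> 8 * exp 16 * (u * ln (u + 1) / real r) \<and> \<nu> n r = dickman u * (1 + E)"
    unfolding Let_def X_def u_def by blast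
qed

end
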